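(* For every positive integer $d$, the set $$\Omega_d = \{z\in CL : \text{there exists a } CL\text{-polynomial } p \text{ of degree } d \text{ satisfying } (\diamondsuit) \text{ with } p(z)=0\}$$ is connected (as a subspace of $\mathbb{C}$).
   Context: The critical line is $CL=\{z\in\mathbb{C} : \mathrm{Re}(z)=-\frac12\}$. A $CL$-polynomial of degree $d$ is a polynomial of the form $f(z)=b(z)\prod_{i=0}^{\lfloor d/2\rfloor-1}(z^2+z+c_i)$, where the $c_i$ are real numbers $\geq\frac14$ and, for a non-zero constant $a$, $b(z)=a$ if $d$ is even and $b(z)=a(2z+1)$ if $d$ is odd. For a polynomial $f$ of degree $d$, the $h^*$-polynomial is the polynomial $h^*(t)=\sum_{i=0}^d h^*_i t^i$ with $\sum_{k\ge 0} f(k)t^k=\frac{h^*(t)}{(1-t)^{d+1}}$; equivalently $f(z)=\sum_{i=0}^d h_i^*\binom{z+d-i}{d}$. Palindromic means $h^*_i=h^*_{d-i}$ for all $0\le i\le d$. Property $(\diamondsuit)$ means that all $h^*_i$ are real and $\ge 0$ and that $h^*$ is palindromic. *)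

theory Defs
  imports "HOL-Analysis.Analysis" "HOL-Computational_Algebra.Polynomial_FPS"
begin

definition critical_line :: "complex set" where
  "critical_line = {z. Re z = - 1 / 2}"

definition CL_poly :: "nat \<Rightarrow> complex poly \<Rightarrow> bool" where
  "CL_poly d f \<longleftrightarrow>
     (\<exists>(a::complex) (c::nat \<Rightarrow> real).
        a \<noteq> 0 \<and> (\<forall>i < d div 2. c i \<ge> 1 / 4) \<and>
        f = (if even d then [:a:] else smult a [:1, 2:]) *
            (\<Prod>i < d div 2. [:complex_of_real (c i), 1, 1:]))"

definition is_hstar_poly :: "complex poly \<Rightarrow> complex poly \<Rightarrow> bool" where
  "is_hstar_poly f h \<longleftrightarrow>
     degree h \<le> degree f \<and>
     Abs_fps (\<lambda>k. poly f (of_nat k)) = fps_of_poly h / (1 - fps_X) ^ (degree f + 1)"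

definition hstar_poly :: "complex poly \<Rightarrow> complex poly" where
  "hstar_poly f = (THE h. is_hstar_poly f h)"

lemma degree_CL_poly:
  assumes "CL_poly d f"
  shows "degree f = d"
proof -
  obtain a c where a: "a \<noteq> 0" and f: "f = (if even d then [:a:] else smult a [:1, 2:]) *
      (\<Prod>i < d div 2. [:complex_of_real (c i), 1, 1:])"
    using assms unfolding CL_poly_def by blast
  have "degree (\<Prod>i < d div 2. [:complex_of_real (c i), 1, 1:]) = (\<Sum>i < d div 2. 2)"
    by (subst degree_prod_eq_sum_degree) auto
  moreover have "(\<Prod>i < d div 2. [:complex_of_real (c i), 1, 1:]) \<noteq> 0"
    by (simp add: prod_zero_iff)
  moreover have "(if even d then [:a:] else smult a [:1, 2:]) \<noteq> 0"
    "degree (if even d then [:a:] else smult a [:1, 2:]) = d mod 2"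
    using a by (auto simp: odd_iff_mod_2_eq_one)
  ultimately show ?thesis unfolding f by (subst degree_mult_eq) auto
qed

lemma degree_forward_difference_less:
  fixes f :: "complex poly"
  assumes "degree f < Suc n" "n > 0"
  shows "degree (pcompose f [:1, 1:] - f) < n"
proof (cases "degree f = n")
  case False
  then have "degree f < n" using assms by simp
  then show ?thesis by (intro degree_diff_less) (simp_all add: degree_pcompose)
next
  case True
  have deg: "degree (pcompose f [:1, 1:]) = n" using True by (simp add: degree_pcompose)
  have "lead_coeff (pcompose f [:1, 1:]) = lead_coeff f"
    by (subst lead_coeff_comp) auto
  then have "coeff (pcompose f [:1, 1:] - f) n = 0" using deg True by simp
  moreover have "degree (pcompose f [:1, 1:] - f) \<le> n"
    using deg True by (intro degree_diff_le) auto
  ultimately show ?thesis using \<open>n > 0\<close>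
    by (metis degree_0 le_neq_implies_less leading_coeff_0_iff)
qed

lemma hstar_numerator_exists:
  fixes f :: "complex poly"
  assumes "degree f < n"
  shows "\<exists>h. degree h < n \<and>
    Abs_fps (\<lambda>k. poly f (of_nat k)) * (1 - fps_X) ^ n = fps_of_poly h"
  using assms
proof (induction n arbitrary: f)
  case 0
  then show ?case by simp
next
  case (Suc n)
  let ?g = "pcompose f [:1, 1:] - f"
  let ?F = "Abs_fps (\<lambda>k. poly f (of_nat k))"
  let ?G = "Abs_fps (\<lambda>k. poly ?g (of_nat k))"
  have step: "?F * (1 - fps_X) = fps_const (poly f 0) + fps_X * ?G"
  proof (rule fps_ext)
    fix k show "fps_nth (?F * (1 - fps_X)) k = fps_nth (fps_const (poly f 0) + fps_X * ?G) k"
      by (cases k) (simp_all add: right_diff_distrib poly_pcompose add_ac)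
  qed
  show ?case
  proof (cases "n = 0")
    case True
    then obtain c where "f = [:c:]" using Suc.prems by (auto elim: degree_eq_zeroE)
    then have "?G = 0" by (simp add: fps_eq_iff)
    then show ?thesis using step True
      by (intro exI[of _ "[:poly f 0:]"]) (simp add: fps_of_poly_const)
  next
    case False
    then have "degree ?g < n" using degree_forward_difference_less Suc.prems by blast
    from Suc.IH[OF this] obtain h where h: "degree h < n"
      "?G * (1 - fps_X) ^ n = fps_of_poly h" by blast
    let ?k = "smult (poly f 0) ([:1, -1:] ^ n) + pCons 0 h"
    have 1: "fps_of_poly [:1, -1::complex:] = 1 - fps_X"
      by (simp add: fps_of_poly_pCons fps_of_poly_const
          flip: fps_const_neg)
    have "degree (smult (poly f 0) ([:1, -1:] ^ n)) \<le> n"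
      by (rule order.trans[OF degree_smult_le]) (use degree_power_le[of "[:1, -1::complex:]" n] in simp)
    moreover have "degree (pCons 0 h) \<le> n"
      using h(1) by (metis Suc_leI degree_pCons_le le_trans)
    ultimately have "degree ?k < Suc n" using degree_add_le less_Suc_eq_le by blast
    moreover have "?F * (1 - fps_X) ^ Suc n = (?F * (1 - fps_X)) * (1 - fps_X) ^ n"
      by (simp add: mult.assoc)
    then have "?F * (1 - fps_X) ^ Suc n =
        fps_const (poly f 0) * (1 - fps_X) ^ n + fps_X * (?G * (1 - fps_X) ^ n)"
      unfolding step by (simp only: distrib_right mult.assoc)
    then have "?F * (1 - fps_X) ^ Suc n = fps_of_poly ?k"
      unfolding h(2) by (simp add: fps_of_poly_add fps_of_poly_smult fps_of_poly_power
          fps_of_poly_pCons 1 mult.commute)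
    ultimately show ?thesis by blast
  qed
qed

lemma is_hstar_poly_iff:
  "is_hstar_poly f h \<longleftrightarrow> degree h \<le> degree f \<and>
     Abs_fps (\<lambda>k. poly f (of_nat k)) * (1 - fps_X) ^ (degree f + 1) = fps_of_poly h"
proof -
  let ?D = "(1 - fps_X :: complex fps) ^ (degree f + 1)"
  have "fps_nth ?D 0 \<noteq> 0" by (simp add: fps_nth_power_0)
  then have "inverse ?D * ?D = 1" "fps_of_poly h / ?D = fps_of_poly h * inverse ?D"
    by (blast intro: inverse_mult_eq_1, blast intro: fps_divide_unit)
  moreover have "F = fps_of_poly h * J \<longleftrightarrow> F * E = fps_of_poly h"
    if "J * E = 1" for F J E :: "complex fps"
  proof
    assume "F = fps_of_poly h * J"
    then have "F * E = fps_of_poly h * (J * E)" by (simp only: mult.assoc)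
    then show "F * E = fps_of_poly h" using that by simp
  next
    assume F: "F * E = fps_of_poly h"
    have "fps_of_poly h * J = F * (J * E)" unfolding F[symmetric] by (simp only: mult_ac)
    then show "F = fps_of_poly h * J" using that by simp
  qed
  ultimately show ?thesis unfolding is_hstar_poly_def by metis
qed

lemma hstar_poly_unique_exists: "\<exists>!h. is_hstar_poly f h"
proof -
  obtain h where "is_hstar_poly f h"
    unfolding is_hstar_poly_iff using hstar_numerator_exists[of f "degree f + 1"] by auto
  moreover have "h' = h''" if "is_hstar_poly f h'" "is_hstar_poly f h''" for h' h''
    using that unfolding is_hstar_poly_iff by (metis fps_of_poly_eq_iff)
  ultimately show ?thesis by blast
qed

lemma is_hstar_poly_hstar_poly: "is_hstar_poly f (hstar_poly f)"
  unfolding hstar_poly_def by (rule theI'[OF hstar_poly_unique_exists])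

definition diamond :: "complex poly \<Rightarrow> bool" where
  "diamond f \<longleftrightarrow>
     (\<forall>i \<le> degree f. coeff (hstar_poly f) i \<in> \<real> \<and> Re (coeff (hstar_poly f) i) \<ge> 0) \<and>
     (\<forall>i \<le> degree f. coeff (hstar_poly f) i = coeff (hstar_poly f) (degree f - i))"

definition Omega :: "nat \<Rightarrow> complex set" where
  "Omega d = {z \<in> critical_line. \<exists>p. CL_poly d p \<and> diamond p \<and> poly p z = 0}"

end

theory Submission
  imports Defs "HOL-Computational_Algebra.Fundamental_Theorem_Algebra"
begin

text \<open>
  Put \<open>x = z + 1/2\<close>, so that the critical line is \<open>x = \<i>y\<close>. For \<open>y > 0\<close>, up to the common factor
  \<open>(\<i>y)\<^sup>d\<close> the binomials \<open>(z + d - i) gchoose d\<close> have argument of modulus at most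
  \<open>\<Theta> d y = (\<Sum>j<d. arctan ((j + 1/2) / y))\<close> at \<open>x = \<i>y\<close>. If \<open>\<Theta> d y < \<pi>/2\<close>, no nonnegative combination
  of them vanishes there. Conversely, if \<open>\<Theta> d y \<ge> \<pi>/2\<close>, there are \<open>m < d\<close> and \<open>0 < \<kappa> \<le> m + 1/2\<close> with
  \<open>\<Theta> m y + arctan (\<kappa> / y) = \<pi>/2\<close>, and the product of \<open>x\<^bsup>d-m-1\<^esup>\<close> with
  \<open>(x + \<kappa>) * (\<Prod>j<m. x + j + 1/2) + (x - \<kappa>) * (\<Prod>j<m. x - j - 1/2)\<close>
  vanishes at \<open>\<i>y\<close>. It has its roots on the line by the Hermite--Biehler argument and a nonnegative
  palindromic \<open>h\<^sup>*\<close> because it is a convex combination of the cases \<open>\<kappa> = 0\<close> and \<open>\<kappa> = m + 1/2\<close> and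
  multiplication by \<open>x\<close> preserves that cone. As \<open>\<Theta> d y\<close> decreases in \<open>y\<close>, the set is
  a segment around \<open>-1/2\<close>.
\<close>

section \<open>The binomial basis and the cone of palindromic nonnegative combinations\<close>

text \<open>This is \<open>(z + d - i) gchoose d\<close> as a polynomial in z. Its numerator over
  \<open>(1 - t)^(d+1)\<close> is \<open>t^i\<close>, so the \<open>h*\<close> entries are the
  coordinates in this basis.\<close>

definition shifted_binom :: "nat \<Rightarrow> nat \<Rightarrow> complex poly" where
  "shifted_binom d i = smult (1 / fact d) (\<Prod>j<d. [:of_nat d - of_nat i - of_nat j, 1:])"

lemma poly_shifted_binom:
  "poly (shifted_binom d i) z = (\<Prod>j<d. z + (of_nat d - of_nat i - of_nat j)) / fact d"
  by (simp add: shifted_binom_def poly_prod add.commute)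

text \<open>The roots of \<open>shifted_binom n i\<close> are the n consecutive integers ending at
  \<open>i - 1\<close>. Raising n adjoins the next integer below, \<open>i - n - 1\<close>, or the
  next one above, \<open>i\<close>.\<close>

lemma shifted_binom_Suc:
  "smult (of_nat (Suc n)) (shifted_binom (Suc n) i) =
     [:of_nat (Suc n) - of_nat i, 1:] * shifted_binom n i"
  "smult (of_nat (Suc n)) (shifted_binom (Suc n) (Suc i)) = [:- of_nat i, 1:] * shifted_binom n i"
proof -
  have c: "of_nat (Suc n) * (1 / fact (Suc n)) = (1 / fact n :: complex)"
    by (simp add: divide_simps del: of_nat_Suc)
  have "(\<Prod>j<Suc n. [:of_nat (Suc n) - of_nat i - of_nat j, 1::complex:]) =
      [:of_nat (Suc n) - of_nat i, 1:] * (\<Prod>j<n. [:of_nat n - of_nat i - of_nat j, 1:])"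
    by (subst prod.lessThan_Suc_shift) (simp add: algebra_simps)
  then show "smult (of_nat (Suc n)) (shifted_binom (Suc n) i) =
      [:of_nat (Suc n) - of_nat i, 1:] * shifted_binom n i"
    unfolding shifted_binom_def smult_smult c by (simp only: mult_smult_right)
  have "(\<Prod>j<Suc n. [:of_nat (Suc n) - of_nat (Suc i) - of_nat j, 1::complex:]) =
      [:- of_nat i, 1:] * (\<Prod>j<n. [:of_nat n - of_nat i - of_nat j, 1:])"
    by (simp add: algebra_simps)
  then show "smult (of_nat (Suc n)) (shifted_binom (Suc n) (Suc i)) =
      [:- of_nat i, 1:] * shifted_binom n i"
    unfolding shifted_binom_def smult_smult c by (simp only: mult_smult_right)
qed

text \<open>The point -1/2 lies between the two adjoinable roots \<open>i - n - 1\<close> and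
  \<open>i\<close>, so \<open>z + 1/2\<close> is a convex combination of the two new linear factors.
  This is the source of the positive weights.\<close>

lemma half_shift_times_shifted_binom:
  assumes "i \<le> n"
  shows "[:1/2, 1:] * shifted_binom n i =
     smult (of_real (real i + 1/2)) (shifted_binom (Suc n) i) +
     smult (of_real (real (n - i) + 1/2)) (shifted_binom (Suc n) (Suc i))"
proof -
  let ?N = "of_nat (Suc n) :: complex"
  let ?a = "of_real (real i + 1/2) :: complex" and ?b = "of_real (real (n - i) + 1/2) :: complex"
  have "smult ?N (smult ?a (shifted_binom (Suc n) i) + smult ?b (shifted_binom (Suc n) (Suc i)))
      = smult ?a (smult ?N (shifted_binom (Suc n) i)) +
        smult ?b (smult ?N (shifted_binom (Suc n) (Suc i)))"
    by (simp only: smult_add_right smult_smult mult.commute)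
  also have "\<dots> = (smult ?a [:?N - of_nat i, 1:] + smult ?b [:- of_nat i, 1:]) * shifted_binom n i"
    unfolding shifted_binom_Suc(2) shifted_binom_Suc(1)[of n i] by (simp only: distrib_right mult_smult_left)
  also have "smult ?a [:?N - of_nat i, 1:] + smult ?b [:- of_nat i, 1:] = smult ?N [:1/2, 1:]"
    using assms by (simp add: of_nat_diff algebra_simps)
  finally have "smult ?N (smult ?a (shifted_binom (Suc n) i) + smult ?b (shifted_binom (Suc n) (Suc i)))
      = smult ?N ([:1/2, 1:] * shifted_binom n i)"
    by (simp only: mult_smult_left)
  then show ?thesis
    by (metis of_nat_neq_0 smult_eq_iff divide_self smult_1_left)
qed

section \<open>Generating functions of the binomial basis\<close>

lemma poly_shifted_binom_of_nat:
  assumes "i \<le> d"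
  shows "poly (shifted_binom d i) (of_nat k) = of_nat ((k + d - i) choose d)"
proof -
  have "of_nat ((k + d - i) choose d) = (of_nat (k + d - i) gchoose d :: complex)"
    by (rule binomial_gbinomial)
  also have "\<dots> = (\<Prod>j<d. of_nat k + (of_nat d - of_nat i - of_nat j)) / fact d"
    using assms by (simp add: gbinomial_prod_rev of_nat_diff atLeast0LessThan algebra_simps)
  finally show ?thesis by (simp add: poly_shifted_binom)
qed

text \<open>The negative binomial series of \<open>1 / (1 - t)^(d+1)\<close> is shifted by i places.
  The first i values vanish because there the upper index of the binomial is below d.\<close>

lemma shifted_binom_generating_function:
  assumes "i \<le> d"
  shows "Abs_fps (\<lambda>k. poly (shifted_binom d i) (of_nat k)) * (1 - fps_X) ^ (d + 1) = fps_X ^ i"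
proof -
  have inv: "inverse ((1 - fps_X) ^ (d + 1) :: complex fps) = Abs_fps (\<lambda>k. of_nat ((d + k) choose k))"
    using one_minus_const_fps_X_neg_power'[of "d + 1" "1::complex"] by simp
  have "Abs_fps (\<lambda>k. poly (shifted_binom d i) (of_nat k)) =
      fps_X ^ i * Abs_fps (\<lambda>k. of_nat ((d + k) choose k))"
  proof (rule fps_ext)
    fix k
    have "(k + d - i) choose d = (d + (k - i)) choose (k - i)" if "i \<le> k"
      using that binomial_symmetric[of d "d + (k - i)"] by (simp add: add.commute)
    moreover have "(k + d - i) choose d = 0" if "k < i"
      using that assms by (intro binomial_eq_0) auto
    ultimately show "fps_nth (Abs_fps (\<lambda>k. poly (shifted_binom d i) (of_nat k))) k =
        fps_nth (fps_X ^ i * Abs_fps (\<lambda>k. of_nat ((d + k) choose k))) k"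
      using assms by (simp add: poly_shifted_binom_of_nat fps_X_power_mult_nth)
  qed
  moreover have "inverse ((1 - fps_X) ^ (d + 1) :: complex fps) * (1 - fps_X) ^ (d + 1) = 1"
    by (rule inverse_mult_eq_1) (simp add: fps_nth_power_0)
  ultimately show ?thesis unfolding inv[symmetric] by (simp only: mult.assoc mult_1_right)
qed

text \<open>A generator has numerator \<open>t^i + t^(d-i)\<close>, which builds in the palindromic
  symmetry. The degree of a member may be less than d, since the scalar 0 is allowed.\<close>

inductive diamond_cone :: "nat \<Rightarrow> complex poly \<Rightarrow> bool" for d where
  gen: "i \<le> d \<Longrightarrow> diamond_cone d (shifted_binom d i + shifted_binom d (d - i))"
| add: "diamond_cone d f \<Longrightarrow> diamond_cone d g \<Longrightarrow> diamond_cone d (f + g)"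
| scale: "diamond_cone d f \<Longrightarrow> r \<ge> 0 \<Longrightarrow> diamond_cone d (smult (of_real r) f)"

text \<open>The weights obtained for i and for \<open>n - i\<close> are interchanged, so the four
  resulting terms regroup into two generators, at i and at \<open>Suc i\<close>.\<close>

lemma diamond_cone_half_shift:
  assumes "diamond_cone n f"
  shows "diamond_cone (Suc n) ([:1/2, 1:] * f)"
  using assms
proof induction
  case (gen i)
  let ?E = "shifted_binom (Suc n)"
  have eq: "[:1/2, 1:] * (shifted_binom n i + shifted_binom n (n - i)) =
      smult (of_real (real i + 1/2)) (?E i + ?E (Suc n - i)) +
      smult (of_real (real (n - i) + 1/2)) (?E (Suc i) + ?E (Suc n - Suc i))"
    using gen half_shift_times_shifted_binom[of i n] half_shift_times_shifted_binom[of "n - i" n]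
    by (simp add: distrib_left smult_add_right Suc_diff_le)
  have c: "diamond_cone (Suc n) (?E i + ?E (Suc n - i))"
    "diamond_cone (Suc n) (?E (Suc i) + ?E (Suc n - Suc i))"
    using gen diamond_cone.gen[of i "Suc n"] diamond_cone.gen[of "Suc i" "Suc n"] by auto
  show ?case unfolding eq
    by (rule diamond_cone.add[OF diamond_cone.scale[OF c(1)] diamond_cone.scale[OF c(2)]]) auto
next
  case (add f g)
  then show ?case by (simp only: distrib_left diamond_cone.add)
next
  case (scale f r)
  then show ?case by (simp only: mult_smult_right diamond_cone.scale)
qed

lemma diamond_cone_half_shift_power:
  assumes "diamond_cone n f"
  shows "diamond_cone (n + k) ([:1/2, 1:] ^ k * f)"
proof (induction k)
  case (Suc k)
  then show ?case using diamond_cone_half_shift[OF Suc] by (simp only: power_Suc mult.assoc add_Suc_right)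
qed (use assms in simp)

text \<open>The exponent is \<open>d + 1\<close> instead of \<open>degree f + 1\<close>, so that the
  induction survives a drop of the degree.\<close>

lemma diamond_cone_numerator:
  assumes "diamond_cone d f"
  shows "\<exists>h. degree h \<le> d \<and> Abs_fps (\<lambda>k. poly f (of_nat k)) * (1 - fps_X) ^ (d + 1) = fps_of_poly h \<and>
    (\<forall>i\<le>d. coeff h i \<in> \<real> \<and> Re (coeff h i) \<ge> 0 \<and> coeff h i = coeff h (d - i))"
  using assms
proof induction
  case (gen i)
  let ?h = "monom 1 i + monom 1 (d - i) :: complex poly"
  have "Abs_fps (\<lambda>k. poly (shifted_binom d i + shifted_binom d (d - i)) (of_nat k)) =
      Abs_fps (\<lambda>k. poly (shifted_binom d i) (of_nat k)) +
      Abs_fps (\<lambda>k. poly (shifted_binom d (d - i)) (of_nat k))"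
    by (simp add: fps_eq_iff)
  then have "Abs_fps (\<lambda>k. poly (shifted_binom d i + shifted_binom d (d - i)) (of_nat k)) *
      (1 - fps_X) ^ (d + 1) = fps_of_poly ?h"
    using gen shifted_binom_generating_function[of i d] shifted_binom_generating_function[of "d - i" d]
    by (simp only: distrib_right fps_of_poly_add fps_of_poly_monom' diff_le_self)
  moreover have "degree ?h \<le> d"
    using gen by (intro degree_add_le order.trans[OF degree_monom_le]) auto
  moreover have "\<forall>k\<le>d. coeff ?h k \<in> \<real> \<and> Re (coeff ?h k) \<ge> 0 \<and> coeff ?h k = coeff ?h (d - k)"
    using gen by auto
  ultimately show ?case by blast
next
  case (add f g)
  then obtain h1 h2 where
    h1: "degree h1 \<le> d" "Abs_fps (\<lambda>k. poly f (of_nat k)) * (1 - fps_X) ^ (d + 1) = fps_of_poly h1"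
      "\<forall>i\<le>d. coeff h1 i \<in> \<real> \<and> Re (coeff h1 i) \<ge> 0 \<and> coeff h1 i = coeff h1 (d - i)" and
    h2: "degree h2 \<le> d" "Abs_fps (\<lambda>k. poly g (of_nat k)) * (1 - fps_X) ^ (d + 1) = fps_of_poly h2"
      "\<forall>i\<le>d. coeff h2 i \<in> \<real> \<and> Re (coeff h2 i) \<ge> 0 \<and> coeff h2 i = coeff h2 (d - i)"
    by blast
  have "Abs_fps (\<lambda>k. poly (f + g) (of_nat k)) =
      Abs_fps (\<lambda>k. poly f (of_nat k)) + Abs_fps (\<lambda>k. poly g (of_nat k))"
    by (simp add: fps_eq_iff)
  then have "Abs_fps (\<lambda>k. poly (f + g) (of_nat k)) * (1 - fps_X) ^ (d + 1) = fps_of_poly (h1 + h2)"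
    by (simp only: distrib_right h1 h2 fps_of_poly_add)
  moreover have "\<forall>i\<le>d. coeff (h1 + h2) i \<in> \<real> \<and> Re (coeff (h1 + h2) i) \<ge> 0 \<and>
      coeff (h1 + h2) i = coeff (h1 + h2) (d - i)"
    unfolding coeff_add plus_complex.simps
    using h1(3) h2(3) by (metis Reals_add add_nonneg_nonneg)
  ultimately show ?case using degree_add_le[OF h1(1) h2(1)] by blast
next
  case (scale f r)
  then obtain h where
    h: "degree h \<le> d" "Abs_fps (\<lambda>k. poly f (of_nat k)) * (1 - fps_X) ^ (d + 1) = fps_of_poly h"
      "\<forall>i\<le>d. coeff h i \<in> \<real> \<and> Re (coeff h i) \<ge> 0 \<and> coeff h i = coeff h (d - i)"
    by blast
  have "Abs_fps (\<lambda>k. poly (smult (of_real r) f) (of_nat k)) =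
      fps_const (of_real r) * Abs_fps (\<lambda>k. poly f (of_nat k))"
    by (simp add: fps_eq_iff)
  then have "Abs_fps (\<lambda>k. poly (smult (of_real r) f) (of_nat k)) * (1 - fps_X) ^ (d + 1) =
      fps_of_poly (smult (of_real r) h)"
    by (simp only: mult.assoc h fps_of_poly_smult)
  moreover have "\<forall>i\<le>d. coeff (smult (of_real r) h) i \<in> \<real> \<and>
      Re (coeff (smult (of_real r) h) i) \<ge> 0 \<and>
      coeff (smult (of_real r) h) i = coeff (smult (of_real r) h) (d - i)"
    unfolding coeff_smult times_complex.simps Re_complex_of_real Im_complex_of_real mult_zero_left diff_zero
    using h(3) scale(2) by (metis Reals_mult Reals_of_real mult_nonneg_nonneg)
  ultimately show ?case using order.trans[OF degree_smult_le h(1)] by blast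
qed

lemma diamond_cone_imp_diamond:
  assumes "diamond_cone d f" "degree f = d"
  shows "diamond f"
proof -
  obtain h where h: "is_hstar_poly f h"
      "\<forall>i\<le>d. coeff h i \<in> \<real> \<and> Re (coeff h i) \<ge> 0 \<and> coeff h i = coeff h (d - i)"
    using diamond_cone_numerator[OF assms(1)] assms(2) unfolding is_hstar_poly_iff by blast
  have "hstar_poly f = h"
    using h(1) is_hstar_poly_hstar_poly hstar_poly_unique_exists by blast
  then show ?thesis unfolding diamond_def using h(2) assms(2) by blast
qed

text \<open>Both sides have the same generating function, hence agree at every natural number, and a
  polynomial with infinitely many roots is 0.\<close>

lemma hstar_poly_expansion:
  "f = (\<Sum>i\<le>degree f. smult (coeff (hstar_poly f) i) (shifted_binom (degree f) i))"
proof -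
  define d where "d = degree f"
  define h where "h = hstar_poly f"
  define g where "g = (\<Sum>i\<le>d. smult (coeff h i) (shifted_binom d i))"
  have h: "degree h \<le> d"
    "Abs_fps (\<lambda>k. poly f (of_nat k)) * (1 - fps_X) ^ (d + 1) = fps_of_poly h"
    using is_hstar_poly_hstar_poly[of f] unfolding is_hstar_poly_iff d_def h_def by auto
  have "Abs_fps (\<lambda>k. poly g (of_nat k)) =
      (\<Sum>i\<le>d. fps_const (coeff h i) * Abs_fps (\<lambda>k. poly (shifted_binom d i) (of_nat k)))"
    by (simp add: fps_eq_iff g_def poly_sum fps_sum_nth)
  then have "Abs_fps (\<lambda>k. poly g (of_nat k)) * (1 - fps_X) ^ (d + 1) =
      (\<Sum>i\<le>d. fps_const (coeff h i) * fps_X ^ i)"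
    by (simp only: sum_distrib_right mult.assoc)
      (intro sum.cong refl, simp only: atMost_iff shifted_binom_generating_function)
  also have "\<dots> = fps_of_poly h"
    using h(1) by (auto simp: fps_eq_iff fps_sum_nth fps_X_power_iff if_distrib coeff_eq_0
        cong: if_cong)
  finally have "Abs_fps (\<lambda>k. poly g (of_nat k)) * (1 - fps_X) ^ (d + 1) =
      Abs_fps (\<lambda>k. poly f (of_nat k)) * (1 - fps_X) ^ (d + 1)" using h(2) by simp
  moreover have "(1 - fps_X :: complex fps) ^ (d + 1) \<noteq> 0"
    by (metis fps_nonzeroI fps_nth_power_0 fps_sub_nth fps_one_nth fps_X_nth diff_zero power_one
        zero_neq_one)
  ultimately have eq: "Abs_fps (\<lambda>k. poly g (of_nat k)) = Abs_fps (\<lambda>k. poly f (of_nat k))"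
    using mult_right_cancel by blast
  have "range (of_nat :: nat \<Rightarrow> complex) \<subseteq> {x. poly (g - f) x = 0}"
    using eq by (auto simp: fps_eq_iff)
  then have "infinite {x. poly (g - f) x = 0}"
    using infinite_super range_inj_infinite inj_of_nat by blast
  then have "g - f = 0" using poly_roots_finite by blast
  then show ?thesis unfolding g_def d_def h_def by simp
qed

section \<open>Polynomials with all roots on the critical line\<close>

lemma CL_poly_mult_quadratic:
  assumes "CL_poly d g" "c \<ge> 1/4"
  shows "CL_poly (d + 2) ([:complex_of_real c, 1, 1:] * g)"
proof -
  obtain a e where a: "a \<noteq> 0" "\<forall>i < d div 2. e i \<ge> (1/4::real)"
    "g = (if even d then [:a:] else smult a [:1, 2:]) * (\<Prod>i < d div 2. [:complex_of_real (e i), 1, 1:])"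
    using assms unfolding CL_poly_def by blast
  let ?e = "e(d div 2 := c)"
  have "(\<Prod>i < (d + 2) div 2. [:complex_of_real (?e i), 1, 1:]) =
      (\<Prod>i < d div 2. [:complex_of_real (e i), 1, 1:]) * [:complex_of_real c, 1, 1:]"
    by simp
  then have "[:complex_of_real c, 1, 1:] * g = (if even (d + 2) then [:a:] else smult a [:1, 2:]) *
      (\<Prod>i < (d + 2) div 2. [:complex_of_real (?e i), 1, 1:])"
    unfolding a(3) by (simp only: mult_ac even_add even_numeral simp_thms)
  moreover have "\<forall>i < (d + 2) div 2. ?e i \<ge> 1/4"
    using a(2) assms(2) by auto
  ultimately show ?thesis unfolding CL_poly_def using a(1) by blast
qed

text \<open>For odd d a second factor \<open>2z + 1\<close> meets the first, and their product
  \<open>4 (z^2 + z + 1/4)\<close> is a quadratic factor with the extreme value 1/4.\<close>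

lemma CL_poly_mult_linear:
  assumes "CL_poly d g"
  shows "CL_poly (Suc d) ([:1, 2:] * g)"
proof -
  obtain a e where a: "a \<noteq> 0" "\<forall>i < d div 2. e i \<ge> (1/4::real)"
    "g = (if even d then [:a:] else smult a [:1, 2:]) * (\<Prod>i < d div 2. [:complex_of_real (e i), 1, 1:])"
    using assms unfolding CL_poly_def by blast
  show ?thesis
  proof (cases "even d")
    case True
    then show ?thesis unfolding CL_poly_def
      using a by (intro exI[of _ a] exI[of _ e]) (auto simp: smult_add_right mult.commute)
  next
    case False
    let ?e = "e(d div 2 := 1/4)"
    have dv: "Suc d div 2 = Suc (d div 2)" using False by presburger
    have "(\<Prod>i < Suc d div 2. [:complex_of_real (?e i), 1, 1:]) =
        (\<Prod>i < d div 2. [:complex_of_real (e i), 1, 1:]) * [:1/4, 1, 1:]"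
      unfolding dv by simp
    moreover have "[:1, 2:] * smult a [:1, 2:] = [:4 * a:] * [:1/4, 1, 1:]" by simp
    ultimately have "[:1, 2:] * g = [:4 * a:] * (\<Prod>i < Suc d div 2. [:complex_of_real (?e i), 1, 1:])"
      unfolding a(3) using False by (simp only: mult.assoc[symmetric] if_False) (simp only: mult_ac)
    then have "[:1, 2:] * g = (if even (Suc d) then [:4 * a:] else smult (4 * a) [:1, 2:]) *
        (\<Prod>i < Suc d div 2. [:complex_of_real (?e i), 1, 1:])"
      using False by simp
    moreover have "\<forall>i < Suc d div 2. ?e i \<ge> 1/4" using a(2) dv by (auto simp: less_Suc_eq)
    ultimately show ?thesis unfolding CL_poly_def using a(1)
      by (metis mult_eq_0_iff zero_neq_numeral)
  qed
qed

lemma CL_poly_smult: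
  assumes "CL_poly d g" "b \<noteq> 0"
  shows "CL_poly d (smult b g)"
proof -
  obtain a e where a: "a \<noteq> 0" "\<forall>i < d div 2. e i \<ge> (1/4::real)"
    "g = (if even d then [:a:] else smult a [:1, 2:]) * (\<Prod>i < d div 2. [:complex_of_real (e i), 1, 1:])"
    using assms unfolding CL_poly_def by blast
  then show ?thesis unfolding CL_poly_def
    using assms(2) by (intro exI[of _ "b * a"] exI[of _ e]) (auto simp: smult_add_right mult.assoc)
qed

lemma CL_poly_half_shift_power:
  assumes "CL_poly d g"
  shows "CL_poly (d + k) ([:1/2, 1:] ^ k * g)"
proof (induction k)
  case (Suc k)
  have "[:1/2, 1:] ^ Suc k * g = smult (1/2) ([:1, 2:] * ([:1/2, 1:] ^ k * g))"
    by (simp add: algebra_simps smult_add_right)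
  then show ?case using CL_poly_smult[OF CL_poly_mult_linear[OF Suc], of "1/2"] by simp
qed (use assms in simp)

text \<open>Induction on the degree: split off the root -1/2, or a pair z, \<open>-1 - z\<close>
  supplied by the functional equation. The quotient satisfies the functional equation again.\<close>

lemma CL_polyI:
  assumes "degree f = d" "f \<noteq> 0"
    and "\<And>z. poly f z = 0 \<Longrightarrow> Re z = - 1/2"
    and "pcompose f [:-1, -1:] = smult ((-1) ^ d) f"
  shows "CL_poly d f"
  using assms
proof (induction d arbitrary: f rule: less_induct)
  case (less d)
  show ?case
  proof (cases "d = 0")
    case True
    then obtain a where "f = [:a:]" using less.prems(1) degree_eq_zeroE by blast
    then show ?thesis using True less.prems(2) by (simp add: CL_poly_def)
  next
    case False
    then obtain z where z: "poly f z = 0"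
      using fundamental_theorem_of_algebra[of f] less.prems(1) constant_degree[of f] by auto
    then have Re: "Re z = - 1/2" using less.prems(3) by blast
    show ?thesis
    proof (cases "z = - 1/2")
      case True
      then obtain g' where "f = [:1/2, 1:] * g'"
        using z poly_eq_0_iff_dvd[of f z] dvdE by fastforce
      then have f: "f = [:1, 2:] * smult (1/2) g'" by (simp add: smult_add_right)
      define g where "g = smult (1/2) g'"
      note f = f[folded g_def]
      have "g \<noteq> 0" using f less.prems(2) by auto
      then have deg: "degree g = d - 1" "d - 1 < d"
        using f less.prems(1) False by (auto simp: degree_mult_eq simp del: mult_pCons_left)
      \<comment> \<open>The factor \<open>2z + 1\<close> is odd under the reflection, so the sign
        for the quotient is that of \<open>d - 1\<close>.\<close>
      have c: "pcompose [:1, 2:] [:-1, -1:] = smult (-1) [:1, 2 :: complex:]"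
        by (simp add: pcompose_pCons)
      have "smult (-1) ([:1, 2:] * pcompose g [:-1, -1:]) = smult ((-1) ^ d) ([:1, 2:] * g)"
        using less.prems(4) unfolding f pcompose_mult c by (simp only: mult_smult_left)
      then have "[:1, 2:] * pcompose g [:-1, -1:] = smult (-1) (smult ((-1) ^ d) ([:1, 2:] * g))"
        by (metis smult_smult mult_minus1_right minus_minus smult_1_left)
      also have "\<dots> = [:1, 2:] * smult ((-1) ^ (d - 1)) g"
        using False by (cases d) (auto simp del: mult_pCons_left)
      finally have "pcompose g [:-1, -1:] = smult ((-1) ^ (d - 1)) g"
        by (subst (asm) mult_cancel_left) auto
      moreover have "Re w = - 1/2" if "poly g w = 0" for w
        using that less.prems(3)[of w] unfolding f poly_mult by simp
      ultimately have "CL_poly (d - 1) g"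
        using less.IH[OF deg(2)] deg(1) \<open>g \<noteq> 0\<close> by blast
      then show ?thesis using CL_poly_mult_linear False unfolding f by fastforce
    next
      case z_ne: False
      define w where "w = - 1 - z"
      have "poly (pcompose f [:-1, -1:]) z = 0" unfolding less.prems(4) using z by simp
      then have w: "poly f w = 0" by (simp add: poly_pcompose w_def)
      have "w \<noteq> z"
      proof
        assume "w = z"
        then have "z = - 1/2" unfolding w_def by (simp add: field_simps complex_eq_iff)
        then show False using z_ne by simp
      qed
      obtain g1 where g1: "f = [:-z, 1:] * g1" using z poly_eq_0_iff_dvd[of f z] dvdE by blast
      have "(w - z) * poly g1 w = 0" using w unfolding g1 by (simp add: algebra_simps)
      then have "poly g1 w = 0" using \<open>w \<noteq> z\<close> by simp
      then obtain g where "g1 = [:-w, 1:] * g" using poly_eq_0_iff_dvd[of g1 w] dvdE by blast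
      then have "f = ([:-z, 1:] * [:-w, 1:]) * g" using g1 by (simp only: mult.assoc)
      \<comment> \<open>On the critical line reflection is conjugation, so the constant term
        \<open>z * w\<close> is real; it is at least 1/4 because
        \<open>Re z = - 1/2\<close>.\<close>
      moreover have "w = cnj z" using Re by (simp add: w_def complex_eq_iff)
      then have "z * w = of_real ((cmod z)\<^sup>2)" using complex_norm_square by simp
      moreover have "[:-z, 1:] * [:-w, 1:] = [:z * w, - (z + w), 1:]" by (simp add: algebra_simps)
      moreover have "- (z + w) = 1" by (simp add: w_def)
      ultimately have f: "f = [:complex_of_real ((cmod z)\<^sup>2), 1, 1:] * g" by (simp only:)
      have "g \<noteq> 0" using f less.prems(2) by auto
      then have "d = 2 + degree g"
        using f less.prems(1) by (auto simp: degree_mult_eq simp del: mult_pCons_left)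
      then have deg: "degree g = d - 2" "d - 2 < d" "d - 2 + 2 = d" by auto
      have c: "pcompose [:c, 1, 1:] [:-1, -1:] = [:c, 1, 1 :: complex:]" for c
        by (simp add: pcompose_pCons)
      have "[:complex_of_real ((cmod z)\<^sup>2), 1, 1:] * pcompose g [:-1, -1:] =
          [:complex_of_real ((cmod z)\<^sup>2), 1, 1:] * smult ((-1) ^ d) g"
        using less.prems(4) unfolding f pcompose_mult c by (simp only: mult_smult_right)
      then have "pcompose g [:-1, -1:] = smult ((-1) ^ d) g"
        by (subst (asm) mult_cancel_left) auto
      also have "(-1 :: complex) ^ d = (-1) ^ (d - 2)"
        using power_add[of "-1 :: complex" "d - 2" 2] unfolding deg(3) by simp
      finally have sym: "pcompose g [:-1, -1:] = smult ((-1) ^ (d - 2)) g" .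
      have "Re u = - 1/2" if "poly g u = 0" for u
        using that less.prems(3)[of u] unfolding f poly_mult by simp
      then have "CL_poly (d - 2) g"
        by (rule less.IH[OF deg(2) deg(1) \<open>g \<noteq> 0\<close> _ sym])
      moreover have "(cmod z)\<^sup>2 \<ge> 1/4"
        unfolding cmod_power2 Re by (simp add: power2_eq_square)
      ultimately show ?thesis using CL_poly_mult_quadratic[of "d - 2" g "(cmod z)\<^sup>2"] unfolding f deg(3) by blast
    qed
  qed
qed

text \<open>The Hermite--Biehler argument: off the critical line one of the two products
  strictly dominates the other in modulus.\<close>
lemma CL_poly_sum_of_reflected_products:
  fixes \<kappa> :: "nat \<Rightarrow> real"
  assumes "m > 0" and pos: "\<And>j. j < m \<Longrightarrow> \<kappa> j > 0"
  shows "CL_poly m ((\<Prod>j<m. [:1/2 + of_real (\<kappa> j), 1:]) + (\<Prod>j<m. [:1/2 - of_real (\<kappa> j), 1:]))"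
    (is "CL_poly m (?A + ?B)")
proof (rule CL_polyI)
  have deg: "degree (\<Prod>j<m. [:c j, 1::complex:]) = m" for c
    by (subst degree_prod_eq_sum_degree) auto
  have lc: "coeff (\<Prod>j<m. [:c j, 1::complex:]) m = 1" for c
    using lead_coeff_prod[of "\<lambda>j. [:c j, 1::complex:]" "{..<m}"] by (simp add: deg)
  \<comment> \<open>Both products are monic, so the top coefficient is 2 and the degree does not
    drop.\<close>
  have cf: "coeff (?A + ?B) m \<noteq> 0" by (simp add: lc)
  moreover have "degree (?A + ?B) \<le> m" by (intro degree_add_le) (simp_all add: deg)
  ultimately show "degree (?A + ?B) = m" using le_degree by (metis le_antisym)
  show "?A + ?B \<noteq> 0" using cf by (metis coeff_0)
  have c: "pcompose [:1/2 + a, 1:] [:-1, -1:] = smult (-1) [:1/2 - a, 1 :: complex:]" for a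
    by (simp add: pcompose_pCons)
  have c': "pcompose [:1/2 - a, 1:] [:-1, -1:] = smult (-1) [:1/2 + a, 1 :: complex:]" for a
    by (simp add: pcompose_pCons)
  \<comment> \<open>The reflection \<open>z\<close> to \<open>-1 - z\<close> swaps the two products
    up to the sign \<open>(-1)^m\<close>.\<close>
  have "pcompose ?A [:-1, -1:] = smult ((-1) ^ m) ?B" "pcompose ?B [:-1, -1:] = smult ((-1) ^ m) ?A"
    unfolding pcompose_prod c c' prod_smult by simp_all
  then show "pcompose (?A + ?B) [:-1, -1:] = smult ((-1) ^ m) (?A + ?B)"
    unfolding pcompose_add smult_add_right by (simp only: add.commute)
  fix z assume "poly (?A + ?B) z = 0"
  moreover have "poly ?A z = (\<Prod>j<m. z + 1/2 + of_real (\<kappa> j))"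
    "poly ?B z = (\<Prod>j<m. z + 1/2 - of_real (\<kappa> j))"
    unfolding poly_prod by (auto intro!: prod.cong simp: algebra_simps)
  ultimately have "(\<Prod>j<m. z + 1/2 + of_real (\<kappa> j)) = - (\<Prod>j<m. z + 1/2 - of_real (\<kappa> j))"
    by (simp only: poly_add eq_neg_iff_add_eq_0)
  then have eq: "(\<Prod>j<m. cmod (z + 1/2 + of_real (\<kappa> j))) = (\<Prod>j<m. cmod (z + 1/2 - of_real (\<kappa> j)))"
    by (metis norm_minus_cancel prod_norm)
  have lt: "cmod u < cmod v" if "\<bar>Re u\<bar> < \<bar>Re v\<bar>" "Im u = Im v" for u v
    unfolding cmod_def using that abs_le_square_iff[of "Re v" "Re u"] by simp
  \<comment> \<open>Strictness comes from \<open>m > 0\<close>. A smaller factor may be 0, since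
    \<open>z + 1/2\<close> can equal \<kappa> j or its negative.\<close>
  have strict: "prod u {..<m} < prod v {..<m}"
    if "\<And>j. j < m \<Longrightarrow> 0 \<le> u j \<and> u j < v j" for u v :: "nat \<Rightarrow> real"
    using that \<open>m > 0\<close> by (intro prod_mono_strict[of 0]) (auto intro: less_imp_le le_less_trans)
  show "Re z = - 1/2"
  proof (rule ccontr)
    assume "Re z \<noteq> - 1/2"
    then consider "Re z > - 1/2" | "Re z < - 1/2" by linarith
    then show False
    proof cases
      case 1
      then have "cmod (z + 1/2 - of_real (\<kappa> j)) < cmod (z + 1/2 + of_real (\<kappa> j))" if "j < m" for j
        using pos[OF that] by (intro lt) auto
      then have "(\<Prod>j<m. cmod (z + 1/2 - of_real (\<kappa> j))) < (\<Prod>j<m. cmod (z + 1/2 + of_real (\<kappa> j)))"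
        by (intro strict) simp
      then show False using eq by simp
    next
      case 2
      then have "cmod (z + 1/2 + of_real (\<kappa> j)) < cmod (z + 1/2 - of_real (\<kappa> j))" if "j < m" for j
        using pos[OF that] by (intro lt) auto
      then have "(\<Prod>j<m. cmod (z + 1/2 + of_real (\<kappa> j))) < (\<Prod>j<m. cmod (z + 1/2 - of_real (\<kappa> j)))"
        by (intro strict) simp
      then show False using eq by simp
    qed
  qed
qed

section \<open>Arguments of products on the critical line\<close>

lemma one_minus_ii_times_real: "1 - \<i> * of_real t = of_real (sqrt (1 + t\<^sup>2)) * cis (- arctan t)"
proof -
  have "sqrt (1 + t\<^sup>2) > 0" by (smt (verit) real_sqrt_gt_zero zero_le_power2)
  then show ?thesis by (simp add: complex_eq_iff cos_arctan sin_arctan)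
qed

text \<open>Pulling \<open>\<i> * y\<close> out of each factor leaves
  \<open>1 - \<i> * (\<kappa> j / y)\<close>, whose argument is an arctan. The arguments then add as
  real numbers, with no choice of branch.\<close>

lemma prod_imaginary_plus_real:
  fixes \<kappa> :: "nat \<Rightarrow> real"
  assumes "y \<noteq> 0"
  shows "(\<Prod>j<n. \<i> * of_real y + of_real (\<kappa> j)) =
    (\<i> * of_real y) ^ n * (of_real (\<Prod>j<n. sqrt (1 + (\<kappa> j / y)\<^sup>2)) * cis (- (\<Sum>j<n. arctan (\<kappa> j / y))))"
proof -
  have "(\<Prod>j<n. \<i> * of_real y + of_real (\<kappa> j)) =
      (\<Prod>j<n. (\<i> * of_real y) * (of_real (sqrt (1 + (\<kappa> j / y)\<^sup>2)) * cis (- arctan (\<kappa> j / y))))"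
  proof (rule prod.cong)
    fix j
    have "\<i> * of_real y + of_real (\<kappa> j) = (\<i> * of_real y) * (1 - \<i> * of_real (\<kappa> j / y))"
      using assms by (simp add: field_simps)
    then show "\<i> * of_real y + of_real (\<kappa> j) =
        (\<i> * of_real y) * (of_real (sqrt (1 + (\<kappa> j / y)\<^sup>2)) * cis (- arctan (\<kappa> j / y)))"
      unfolding one_minus_ii_times_real .
  qed simp
  moreover have "(\<Prod>j<n. cis (- arctan (\<kappa> j / y))) = cis (- (\<Sum>j<n. arctan (\<kappa> j / y)))"
    by (induction n) (simp_all add: cis_mult add.commute)
  ultimately show ?thesis by (simp add: prod.distrib)
qed

text \<open>For \<open>y > 0\<close> the number \<open>\<Prod>j<n. \<i>y + j + 1/2\<close> has argument \<open>n\<pi>/2 - line_arg n y\<close>.\<close>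
definition line_arg :: "nat \<Rightarrow> real \<Rightarrow> real" where
  "line_arg n y = (\<Sum>j<n. arctan ((real j + 1/2) / y))"

section \<open>Sign, monotonicity and shifts of the argument sum\<close>

lemma line_arg_nonneg: "y > 0 \<Longrightarrow> line_arg n y \<ge> 0"
  unfolding line_arg_def by (intro sum_nonneg) (simp add: zero_le_arctan_iff)

lemma line_arg_mono:
  assumes "y > 0" "m \<le> n"
  shows "line_arg m y \<le> line_arg n y"
  unfolding line_arg_def using assms by (intro sum_mono2) (auto simp: zero_le_arctan_iff)

lemma line_arg_antimono:
  assumes "0 < x" "x \<le> y"
  shows "line_arg n y \<le> line_arg n x"
  unfolding line_arg_def using assms by (intro sum_mono arctan_monotone' divide_left_mono) auto

text \<open>The first i half-integers are the negatives of 1/2, ..., i - 1/2 and the other k are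
  1/2, ..., k - 1/2; arctan is odd.\<close>

lemma sum_arctan_shift:
  "(\<Sum>j<i + k. arctan ((real j + 1/2 - real i) / y)) = line_arg k y - line_arg i y"
proof (induction k)
  case 0
  have "(\<Sum>j<i. arctan ((real j + 1/2 - real i) / y)) = (\<Sum>j<i. - arctan ((real (i - Suc j) + 1/2) / y))"
  proof (rule sum.cong)
    fix j assume "j \<in> {..<i}"
    then have "real j + 1/2 - real i = - (real (i - Suc j) + 1/2)" by (simp add: of_nat_diff)
    then show "arctan ((real j + 1/2 - real i) / y) = - arctan ((real (i - Suc j) + 1/2) / y)"
      by (simp only: minus_divide_left[symmetric] arctan_minus)
  qed simp
  also have "\<dots> = - line_arg i y"
    unfolding sum_negf line_arg_def
    using sum.nat_diff_reindex[of "\<lambda>j. arctan ((real j + 1/2) / y)" i] by simp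
  finally show ?case by (simp add: line_arg_def)
next
  case (Suc k)
  then show ?case by (simp add: line_arg_def)
qed

text \<open>The factors are \<open>\<i> * y\<close> plus half-integers, of which i are negative and
  \<open>d - i\<close> positive; the two groups turn the product in opposite directions.\<close>

lemma shifted_binom_on_critical_line:
  assumes "y > 0" "i \<le> d"
  shows "\<exists>r>0. poly (shifted_binom d i) (Complex (- 1/2) y) =
    (\<i> * of_real y) ^ d * (of_real r * cis (line_arg i y - line_arg (d - i) y))"
proof -
  let ?k = "\<lambda>j. real d - real i - real j - 1/2"
  have "(\<Sum>j<d. arctan (?k j / y)) = (\<Sum>j<d. arctan ((real (d - Suc j) + 1/2 - real i) / y))"
    by (intro sum.cong) (auto simp: of_nat_diff algebra_simps)
  also have "\<dots> = (\<Sum>j<d. arctan ((real j + 1/2 - real i) / y))"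
    by (rule sum.nat_diff_reindex)
  also have "\<dots> = line_arg (d - i) y - line_arg i y"
    using sum_arctan_shift[of i y "d - i"] assms(2) by simp
  finally have arg: "- (\<Sum>j<d. arctan (?k j / y)) = line_arg i y - line_arg (d - i) y" by simp
  define r where "r = (\<Prod>j<d. sqrt (1 + (?k j / y)\<^sup>2))"
  have "1 + t\<^sup>2 > 0" for t :: real by (smt (verit) zero_le_power2)
  then have "r > 0" unfolding r_def by (intro prod_pos) simp
  have "poly (shifted_binom d i) (Complex (- 1/2) y) = (\<Prod>j<d. \<i> * of_real y + of_real (?k j)) / fact d"
    unfolding poly_shifted_binom by (simp add: Complex_eq algebra_simps)
  also have "\<dots> = (\<i> * of_real y) ^ d * (of_real (r / fact d) * cis (line_arg i y - line_arg (d - i) y))"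
    using assms(1) by (simp only: prod_imaginary_plus_real arg r_def) simp
  finally show ?thesis using \<open>r > 0\<close> by (intro exI[of _ "r / fact d"]) simp
qed

text \<open>Otherwise, after division by \<open>(\<i> * y)^d\<close>, every basis value has positive
  real part. The real part of the vanishing sum then forces all \<open>h*\<close> entries to be
  0.\<close>

lemma diamond_root_imp_line_arg_ge:
  assumes "diamond p" "p \<noteq> 0" "y > 0" "poly p (Complex (- 1/2) y) = 0"
  shows "line_arg (degree p) y \<ge> pi / 2"
proof (rule ccontr)
  assume "\<not> line_arg (degree p) y \<ge> pi / 2"
  define d where "d = degree p"
  define h where "h = (\<lambda>i. coeff (hstar_poly p) i)"
  define \<theta> where "\<theta> = (\<lambda>i. line_arg i y - line_arg (d - i) y)"
  have small: "line_arg d y < pi / 2"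
    using \<open>\<not> line_arg (degree p) y \<ge> pi / 2\<close> by (simp add: d_def)
  have h_real: "h i \<in> \<real>" and h_nonneg: "Re (h i) \<ge> 0" if "i \<le> d" for i
    using assms(1) that unfolding diamond_def d_def h_def by blast+
  have h: "h i = of_real (Re (h i))" if "i \<le> d" for i
    using h_real[OF that] by (simp add: complex_is_Real_iff complex_eq_iff)
  \<comment> \<open>Both terms of \<theta> i lie between 0 and \<open>line_arg d y\<close>, so their
    difference has modulus below \<pi>/2.\<close>
  have cos: "cos (\<theta> i) > 0" if "i \<le> d" for i
  proof (rule cos_gt_zero_pi)
    show "- (pi / 2) < \<theta> i" "\<theta> i < pi / 2"
      using small that line_arg_nonneg[OF assms(3), of i] line_arg_nonneg[OF assms(3), of "d - i"]
        line_arg_mono[OF assms(3), of i d] line_arg_mono[OF assms(3), of "d - i" d]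
      by (auto simp: \<theta>_def)
  qed
  obtain r where r: "r i > 0" "poly (shifted_binom d i) (Complex (- 1/2) y) =
      (\<i> * of_real y) ^ d * (of_real (r i) * cis (\<theta> i))" if "i \<le> d" for i
    using shifted_binom_on_critical_line[OF assms(3), of _ d] unfolding \<theta>_def by metis
  have p: "p = (\<Sum>i\<le>d. smult (h i) (shifted_binom d i))"
    unfolding d_def h_def by (rule hstar_poly_expansion)
  have "0 = (\<Sum>i\<le>d. h i * poly (shifted_binom d i) (Complex (- 1/2) y))"
    using assms(4) by (subst (asm) p) (simp add: poly_sum)
  also have "\<dots> = (\<Sum>i\<le>d. (\<i> * of_real y) ^ d * (h i * (of_real (r i) * cis (\<theta> i))))"
    by (intro sum.cong refl) (simp only: r(2) atMost_iff mult.left_commute)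
  also have "\<dots> = (\<i> * of_real y) ^ d * (\<Sum>i\<le>d. h i * (of_real (r i) * cis (\<theta> i)))"
    by (simp only: sum_distrib_left)
  finally have "(\<Sum>i\<le>d. h i * (of_real (r i) * cis (\<theta> i))) = 0" using assms(3) by simp
  then have "Re (\<Sum>i\<le>d. h i * (of_real (r i) * cis (\<theta> i))) = 0" by simp
  moreover have "Re (h i * (of_real (r i) * cis (\<theta> i))) = Re (h i) * (r i * cos (\<theta> i))" if "i \<le> d" for i
    by (subst h[OF that]) simp
  then have "Re (\<Sum>i\<le>d. h i * (of_real (r i) * cis (\<theta> i))) = (\<Sum>i\<le>d. Re (h i) * (r i * cos (\<theta> i)))"
    unfolding Re_sum by (intro sum.cong) (simp_all only: atMost_iff)
  ultimately have "(\<Sum>i\<le>d. Re (h i) * (r i * cos (\<theta> i))) = 0" by simp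
  moreover have "Re (h i) * (r i * cos (\<theta> i)) \<ge> 0" if "i \<le> d" for i
    using h_nonneg r(1) cos that by (intro mult_nonneg_nonneg) (auto intro: less_imp_le)
  ultimately have "Re (h i) * (r i * cos (\<theta> i)) = 0" if "i \<le> d" for i
    using that by (subst (asm) sum_nonneg_eq_0_iff) auto
  then have "Re (h i) = 0" if "i \<le> d" for i
    using that r(1)[OF that] cos[OF that] by fastforce
  then have "h i = 0" if "i \<le> d" for i using h[OF that] that by simp
  then have "p = 0" by (subst p) (intro sum.neutral, simp)
  then show False using assms(2) by simp
qed

section \<open>The shape of the set of roots\<close>

text \<open>This is m! times the generator for i = 0: the two rising and falling products are the
  extreme basis elements.\<close>

lemma diamond_cone_factorials:
  "diamond_cone m ((\<Prod>j<m. [:1 + of_nat j, 1:]) + (\<Prod>j<m. [:- of_nat j, 1:]))"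
proof -
  have "(\<Prod>j<m. [:of_nat m - of_nat 0 - of_nat j, 1 :: complex:]) =
      (\<Prod>j<m. [:1 + of_nat (m - Suc j), 1:])"
    by (intro prod.cong) (auto simp: of_nat_diff)
  also have "\<dots> = (\<Prod>j<m. [:1 + of_nat j, 1:])" by (rule prod.nat_diff_reindex)
  finally have "(\<Prod>j<m. [:1 + of_nat j, 1:]) + (\<Prod>j<m. [:- of_nat j, 1:]) =
      smult (of_real (fact m)) (shifted_binom m 0 + shifted_binom m (m - 0))"
    by (simp add: shifted_binom_def smult_add_right)
  then show ?thesis using diamond_cone.scale[OF diamond_cone.gen[of 0 m], of "fact m"] by simp
qed

text \<open>The expression is affine in \<kappa>. At \<open>m + 1/2\<close> the linear factors
  extend the products to length \<open>Suc m\<close>; at 0 both are \<open>z + 1/2\<close>.\<close>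

lemma diamond_cone_shifted_factorials:
  fixes \<kappa> :: real
  assumes "0 \<le> \<kappa>" "\<kappa> \<le> real m + 1/2"
  shows "diamond_cone (Suc m) ([:1/2 + of_real \<kappa>, 1:] * (\<Prod>j<m. [:1 + of_nat j, 1:]) +
    [:1/2 - of_real \<kappa>, 1:] * (\<Prod>j<m. [:- of_nat j, 1:]))"
proof -
  let ?A = "\<lambda>m. \<Prod>j<m. [:1 + of_nat j, 1 :: complex:]" and ?B = "\<lambda>m. \<Prod>j<m. [:- of_nat j, 1 :: complex:]"
  define \<sigma> where "\<sigma> = \<kappa> / (real m + 1/2)"
  have \<sigma>: "0 \<le> \<sigma>" "\<sigma> \<le> 1" "\<kappa> = \<sigma> * (real m + 1/2)"
    unfolding \<sigma>_def using assms by (auto simp: field_simps)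
  have "[:1/2 + of_real \<kappa>, 1:] = smult (of_real \<sigma>) [:1 + of_nat m, 1:] + smult (of_real (1 - \<sigma>)) [:1/2, 1 :: complex:]"
    "[:1/2 - of_real \<kappa>, 1:] = smult (of_real \<sigma>) [:- of_nat m, 1:] + smult (of_real (1 - \<sigma>)) [:1/2, 1 :: complex:]"
    unfolding \<sigma>(3) by (simp_all add: field_simps)
  then have "[:1/2 + of_real \<kappa>, 1:] * ?A m + [:1/2 - of_real \<kappa>, 1:] * ?B m =
      smult (of_real \<sigma>) (?A (Suc m) + ?B (Suc m)) + smult (of_real (1 - \<sigma>)) ([:1/2, 1:] * (?A m + ?B m))"
    by (simp only: prod.lessThan_Suc distrib_left distrib_right mult_smult_left mult_smult_right
        smult_add_right mult_ac add_ac)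
  moreover have "diamond_cone (Suc m) (smult (of_real \<sigma>) (?A (Suc m) + ?B (Suc m)))"
    using \<sigma>(1) by (intro diamond_cone.scale diamond_cone_factorials)
  moreover have "diamond_cone (Suc m) (smult (of_real (1 - \<sigma>)) ([:1/2, 1:] * (?A m + ?B m)))"
    using \<sigma> by (intro diamond_cone.scale diamond_cone_half_shift diamond_cone_factorials) auto
  ultimately show ?thesis by (simp only: diamond_cone.add)
qed

text \<open>A witness of lower degree is padded with powers of \<open>z + 1/2\<close>, which
  preserve both the root condition and the cone.\<close>

lemma OmegaI:
  assumes "CL_poly n f" "diamond_cone n f" "n \<le> d" "poly ([:1/2, 1:] ^ (d - n) * f) (Complex (- 1/2) y) = 0"
  shows "Complex (- 1/2) y \<in> Omega d"
proof -
  have "CL_poly d ([:1/2, 1:] ^ (d - n) * f)" "diamond_cone d ([:1/2, 1:] ^ (d - n) * f)"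
    using CL_poly_half_shift_power[OF assms(1), of "d - n"]
      diamond_cone_half_shift_power[OF assms(2), of "d - n"] assms(3) by simp_all
  moreover from this have "diamond ([:1/2, 1:] ^ (d - n) * f)"
    using diamond_cone_imp_diamond degree_CL_poly by blast
  ultimately show ?thesis unfolding Omega_def critical_line_def using assms(4) by auto
qed

lemma minus_half_in_Omega:
  assumes "d > 0"
  shows "Complex (- 1/2) 0 \<in> Omega d"
proof (rule OmegaI)
  \<comment> \<open>The constant is 2 because for \<open>d = 0\<close> the generator counts its
    single basis element twice.\<close>
  show "CL_poly 0 [:2:]" by (simp add: CL_poly_def)
  show "diamond_cone 0 [:2:]" using diamond_cone_factorials[of 0] by (simp add: one_pCons)
  show "poly ([:1/2, 1:] ^ (d - 0) * [:2:]) (Complex (- 1/2) 0) = 0"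
    using assms by (simp add: complex_eq_iff zero_power)
qed simp

lemma line_arg_ge_imp_in_Omega:
  assumes "y > 0" "line_arg d y \<ge> pi / 2"
  shows "Complex (- 1/2) y \<in> Omega d"
proof -
  \<comment> \<open>Minimality of n leaves a gap \<alpha> to \<pi>/2 that is positive and at most
    the last arctan term; this yields \<kappa> \<le> m + 1/2 below.\<close>
  define n where "n = (LEAST n. line_arg n y \<ge> pi / 2)"
  have n: "line_arg n y \<ge> pi / 2" "n \<le> d"
    unfolding n_def using assms(2) by (auto intro: LeastI Least_le)
  have "line_arg 0 y < pi / 2" by (simp add: line_arg_def)
  then have "n \<noteq> 0" using n(1) by (metis not_less)
  then obtain m where m: "n = Suc m" using not0_implies_Suc by blast
  have "line_arg m y < pi / 2"
    using not_less_Least[of m "\<lambda>n. line_arg n y \<ge> pi / 2"] m n_def by simp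
  define \<alpha> where "\<alpha> = pi / 2 - line_arg m y"
  have \<alpha>: "0 < \<alpha>" "\<alpha> \<le> arctan ((real m + 1/2) / y)" "\<alpha> < pi / 2"
    using \<open>line_arg m y < pi / 2\<close> n(1) arctan_ubound[of "(real m + 1/2) / y"]
    by (auto simp: \<alpha>_def m line_arg_def)
  \<comment> \<open>Chosen so that \<open>arctan (\<kappa> / y)\<close> fills the gap exactly; 0 <
    \<alpha> < \<pi>/2 makes tan positive and arctan its inverse here.\<close>
  define \<kappa> where "\<kappa> = y * tan \<alpha>"
  have "\<kappa> > 0" unfolding \<kappa>_def using assms(1) \<alpha> tan_gt_zero by simp
  have arg: "arctan (\<kappa> / y) = \<alpha>" unfolding \<kappa>_def using assms(1) \<alpha> by (simp add: arctan_tan)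
  then have "\<kappa> / y \<le> (real m + 1/2) / y" using \<alpha>(2) arctan_le_iff by metis
  then have "\<kappa> \<le> real m + 1/2" using assms(1) by (simp add: divide_le_cancel)
  define k where "k = (\<lambda>j. if j < m then real j + 1/2 else \<kappa>)"
  define F where "F = (\<Prod>j<Suc m. [:1/2 + complex_of_real (k j), 1:]) + (\<Prod>j<Suc m. [:1/2 - of_real (k j), 1:])"
  have CL: "CL_poly (Suc m) F" unfolding F_def
    by (rule CL_poly_sum_of_reflected_products) (auto simp: k_def \<open>\<kappa> > 0\<close>)
  have "F = [:1/2 + of_real \<kappa>, 1:] * (\<Prod>j<m. [:1 + of_nat j, 1:]) +
      [:1/2 - of_real \<kappa>, 1:] * (\<Prod>j<m. [:- of_nat j, 1:])"
    unfolding F_def prod.lessThan_Suc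
    by (simp add: k_def mult.commute del: mult_pCons_left mult_pCons_right)
  then have cone: "diamond_cone (Suc m) F"
    using diamond_cone_shifted_factorials[of \<kappa> m] \<open>\<kappa> > 0\<close> \<open>\<kappa> \<le> real m + 1/2\<close> by simp
  have sum: "(\<Sum>j<Suc m. arctan (k j / y)) = pi / 2"
    using arg by (simp add: k_def \<alpha>_def line_arg_def)
  have sum': "(\<Sum>j<Suc m. arctan (- k j / y)) = - (pi / 2)"
    using sum by (simp add: arctan_minus sum_negf del: sum.lessThan_Suc)
  have "poly F (Complex (- 1/2) y) =
      (\<Prod>j<Suc m. \<i> * of_real y + of_real (k j)) + (\<Prod>j<Suc m. \<i> * of_real y + of_real (- k j))"
    unfolding F_def by (simp add: poly_prod Complex_eq algebra_simps del: prod.lessThan_Suc)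
  \<comment> \<open>The two products have equal moduli, and their phases relative to the common
    power of \<open>\<i> * y\<close> are -\<pi>/2 and \<pi>/2, so they cancel.\<close>
  also have "\<dots> = 0"
    using assms(1) unfolding prod_imaginary_plus_real[OF less_imp_neq[OF assms(1), symmetric]] sum sum'
    by (simp add: complex_eq_iff)
  finally have "poly F (Complex (- 1/2) y) = 0" .
  then show ?thesis using OmegaI[OF CL cone, of d y] n(2) m by simp
qed

text \<open>The leading factor a may be non-real, but \<open>p / a\<close> has real coefficients, so
  the same p vanishes at the conjugate point.\<close>

lemma cnj_in_Omega:
  assumes "z \<in> Omega d"
  shows "cnj z \<in> Omega d"
proof -
  obtain p where p: "z \<in> critical_line" "CL_poly d p" "diamond p" "poly p z = 0"
    using assms unfolding Omega_def by blast
  then obtain a c where a: "a \<noteq> 0" and f: "p = (if even d then [:a:] else smult a [:1, 2:]) *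
      (\<Prod>i < d div 2. [:complex_of_real (c i), 1, 1:])"
    unfolding CL_poly_def by blast
  define Q where "Q = (\<lambda>z::complex. (if even d then 1 else 1 + 2 * z) * (\<Prod>i < d div 2. of_real (c i) + z * (1 + z)))"
  have pQ: "poly p w = a * Q w" for w
    unfolding f Q_def by (simp add: poly_prod algebra_simps)
  have "Q (cnj z) = cnj (Q z)" unfolding Q_def by simp
  then have "poly p (cnj z) = 0" using p(4) a pQ by simp
  then show ?thesis using p unfolding Omega_def critical_line_def by auto
qed

section \<open>Star-shapedness about -1/2\<close>

lemma Complex_in_Omega_imp_line_arg_ge:
  assumes "Complex (- 1/2) y \<in> Omega d" "y > 0" "d > 0"
  shows "line_arg d y \<ge> pi / 2"
proof -
  obtain p where p: "CL_poly d p" "diamond p" "poly p (Complex (- 1/2) y) = 0"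
    using assms unfolding Omega_def by blast
  have "p \<noteq> 0" using degree_CL_poly[OF p(1)] assms(3) by auto
  then show ?thesis using diamond_root_imp_line_arg_ge[OF p(2) _ assms(2) p(3)] degree_CL_poly[OF p(1)]
    by simp
qed

theorem theorem3p10:
  fixes d :: nat
  assumes "d > 0"
  shows "connected (Omega d)"
proof (rule starlike_imp_connected)
  \<comment> \<open>Shrinking a positive y only increases \<open>line_arg d y\<close>, so the bound
    \<pi>/2 persists along the segment down to the centre.\<close>
  have pos: "Complex (- 1/2) (t * y) \<in> Omega d"
    if "Complex (- 1/2) y \<in> Omega d" "y > 0" "0 \<le> t" "t \<le> 1" for y t
  proof (cases "t = 0")
    case True
    then show ?thesis using minus_half_in_Omega[OF assms] by simp
  next
    case False
    then have "0 < t * y" "t * y \<le> y" using that by (auto simp: mult_le_cancel_right1)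
    then show ?thesis
      using Complex_in_Omega_imp_line_arg_ge[OF that(1,2) assms] line_arg_antimono[of "t * y" y d]
      by (intro line_arg_ge_imp_in_Omega) auto
  qed
  \<comment> \<open>Negative y is reduced to \<open>pos\<close> by conjugating before and
    after.\<close>
  have all: "Complex (- 1/2) (t * y) \<in> Omega d"
    if "Complex (- 1/2) y \<in> Omega d" "0 \<le> t" "t \<le> 1" for y t
  proof (cases y "0 :: real" rule: linorder_cases)
    case less
    have "Complex (- 1/2) (- y) \<in> Omega d" using cnj_in_Omega[OF that(1)] by (simp add: complex_cnj)
    then have "Complex (- 1/2) (t * - y) \<in> Omega d" using less that by (intro pos) auto
    from cnj_in_Omega[OF this] show ?thesis by (simp add: complex_cnj)
  next
    case equal
    then show ?thesis using minus_half_in_Omega[OF assms] by simp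
  next
    case greater
    then show ?thesis using pos that by blast
  qed
  show "starlike (Omega d)"
    unfolding starlike_def
  proof (intro bexI ballI subsetI)
    show "Complex (- 1/2) 0 \<in> Omega d" using minus_half_in_Omega[OF assms] .
    fix z w assume z: "z \<in> Omega d" and w: "w \<in> closed_segment (Complex (- 1/2) 0) z"
    have z_eq: "z = Complex (- 1/2) (Im z)"
      using z by (simp add: Omega_def critical_line_def complex_eq_iff)
    obtain t where t: "0 \<le> t" "t \<le> 1" "w = (1 - t) *\<^sub>R Complex (- 1/2) 0 + t *\<^sub>R z"
      using w unfolding closed_segment_def by blast
    have "w = Complex (- 1/2) (t * Im z)"
      unfolding t(3) by (subst z_eq) (simp add: complex_eq_iff field_simps)
    then show "w \<in> Omega d" using all[of "Im z" t] z z_eq t by simp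
  qed
qed

end
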